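(* Let $k,d\ge 1$, let $\mathsf{O}\subseteq\mathbb{R}^d$ be equipped with its Borel $\sigma$-algebra, let $\mathsf{A}\subseteq\mathbb{R}^k$, and let $\mathcal{F}$ be a class of probability distributions on $\mathsf{O}$. Let $T:\mathcal{F}\twoheadrightarrow\mathsf{A}$ be a (possibly set-valued) functional with a strict $\mathcal{F}$-identification function $V:\mathsf{A}\times\mathsf{O}\to\mathbb{R}^k$. Then the following two assertions hold. (i) If $h:\mathsf{A}\to\mathbb{R}^{k\times k}$ is a matrix-valued function with $\det(h(x))\neq 0$ for all $x\in\mathsf{A}$, then $V'(x,y)=h(x)V(x,y)$ is also a strict $\mathcal{F}$-identification function for $T$. (ii) Suppose that $\mathcal{F}$ is convex, that $V$ satisfies the richness condition on $\mathcal{F}$ (defined in the context), and let $V':\mathsf{A}\times\mathsf{O}\to\mathbb{R}^k$ be an $\mathcal{F}$-identification function for $T$. Then there is a matrix-valued function $h:\operatorname{int}(\mathsf{A})\to\mathbb{R}^{k\times k}$ such that $$\bar V'(x,F)=h(x)\,\bar V(x,F)\qquad\text{for all } x\in\operatorname{int}(\mathsf{A}) \text{ and all } F\in\mathcal{F}.$$ Moreover, this $h$ has the following properties. (a) If $V'$ is a strict $\mathcal{F}$-identification function for $T$ and $V'$ also satisfies the richness condition on $\mathcal{F}$, then additionally $\det(h(x))\neq 0$ for all $x\in\operatorname{int}(\mathsf{A})$. (b) If the integrated identification functions $\bar V(\cdot,F)$ and $\bar V'(\cdot,F)$ are continuous for all $F\in\mathcal{F}$, then $h$ is also continuous; in the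 situation of (a), this implies that either $\det(h(x))>0$ for all $x\in\operatorname{int}(\mathsf{A})$ or $\det(h(x))<0$ for all $x\in\operatorname{int}(\mathsf{A})$. (c) If $\mathcal{F}$ satisfies the Dirac approximation condition and $V,V'$ satisfy the regularity condition (both defined in the context), then it even holds that $$V'(x,y)=h(x)V(x,y)\qquad\text{for Lebesgue almost all } (x,y)\in\operatorname{int}(\mathsf{A})\times\mathsf{O}.$$
   Context: Notation. $\operatorname{int}(B)$ and $\operatorname{conv}(B)$ denote the interior and the convex hull of a set $B\subseteq\mathbb{R}^k$. The set $\mathsf{O}\subseteq\mathbb{R}^d$ is the observation domain, and $\mathsf{A}\subseteq\mathbb{R}^k$ is the action domain. The notation $T:\mathcal{F}\twoheadrightarrow\mathsf{A}$ means that $T$ assigns to each $F\in\mathcal{F}$ a subset $T(F)\subseteq\mathsf{A}$ (a point-valued functional is identified with the singleton containing its value). A map $V:\mathsf{A}\times\mathsf{O}\to\mathbb{R}^k$ is called $\mathcal{F}$-integrable if for each of its components $V_i$ the integral $\int_{\mathsf{O}}V_i(x,y)\,\mathrm{d}F(y)$ exists and is finite for all $x\in\mathsf{A}$ and $F\in\mathcal{F}$. In this case $\bar V(x,F)=\int_{\mathsf{O}}V(x,y)\,\mathrm{d}F(y)\in\mathbb{R}^k$ (componentwise integral) for $x\in\mathsf{A}$, $F\in\mathcal{F}$; similarly $\bar V'$ for $V'$. Identification functions. An $\mathcal{F}$-integrable map $V:\mathsf{A}\times\mathsf{O}\to\mathbb{R}^k$ is an $\mathcal{F}$-identification function for $T$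 if for all $x\in\mathsf{A}$ and all $F\in\mathcal{F}$: $x\in T(F)\implies\bar V(x,F)=0$. It is a strict $\mathcal{F}$-identification function for $T$ if for all $x\in\mathsf{A}$ and all $F\in\mathcal{F}$: $x\in T(F)\iff\bar V(x,F)=0$. Richness condition. An $\mathcal{F}$-integrable map $V:\mathsf{A}\times\mathsf{O}\to\mathbb{R}^k$ satisfies the richness condition on $\mathcal{F}$ if for every $x\in\operatorname{int}(\mathsf{A})$ there are $F_1,\ldots,F_{k+1}\in\mathcal{F}$ such that $0\in\operatorname{int}\big(\operatorname{conv}(\{\bar V(x,F_1),\ldots,\bar V(x,F_{k+1})\})\big)$. Dirac approximation condition. $\mathcal{F}$ satisfies this condition if for every $y\in\mathbb{R}^d$ there exist a sequence $(F_n)_{n\in\mathbb{N}}$ of distributions $F_n\in\mathcal{F}$ that converges weakly to the Dirac measure $\delta_y$ and a compact set $K\subset\mathbb{R}^d$ such that the support of $F_n$ is contained in $K$ for all $n$. Regularity condition. $V,V'$ satisfy this condition if for Lebesgue almost all $x\in\operatorname{int}(\mathsf{A})$ the maps $V(x,\cdot)$ and $V'(x,\cdot)$ are locally bounded, and the complement (in $\operatorname{int}(\mathsf{A})\times\mathsf{O}$) of the set $C=\{(x,y)\in\operatorname{int}(\mathsf{A})\times\mathsf{O} : V(x,\cdot)\text{ and }V'(x,\cdot)\text{ are continuous at the point }y\}$ has $(k+d)$-dimensional Lebesgue measure zero.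
   Formalization: The sign dichotomy for det(h) in (b) is stated for connected int(A), as it fails otherwise; in (c), "locally bounded" means bounded on the part of O near every point of R^d, not only near points of O, as (c) can fail for non-closed O. *)

theory Defs
  imports "HOL-Probability.Probability"
begin

definition distribution_on :: "(real ^ 'd) set \<Rightarrow> (real ^ 'd) measure \<Rightarrow> bool" where
  "distribution_on Obs F \<longleftrightarrow> prob_space F \<and> sets F = sets (restrict_space borel Obs)"

(* The measure t * M + (1 - t) * N; intended for M, N with the same measurable sets
   and 0 \<le> t \<le> 1. *)
definition mixture :: "real \<Rightarrow> 'a measure \<Rightarrow> 'a measure \<Rightarrow> 'a measure" where
  "mixture t M N = measure_of (space M) (sets M)
     (\<lambda>B. ennreal t * emeasure M B + ennreal (1 - t) * emeasure N B)"

lemma sets_mixture [simp]: "sets (mixture t M N) = sets M"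
  by (simp add: mixture_def)

lemma space_mixture [simp]: "space (mixture t M N) = space M"
  by (simp add: mixture_def)

lemma emeasure_mixture:
  assumes "sets N = sets M" and B: "B \<in> sets M"
  shows "emeasure (mixture t M N) B = ennreal t * emeasure M B + ennreal (1 - t) * emeasure N B"
  unfolding mixture_def
proof (rule emeasure_measure_of_sigma)
  show "sigma_algebra (space M) (sets M)" ..
  show "positive (sets M) (\<lambda>B. ennreal t * emeasure M B + ennreal (1 - t) * emeasure N B)"
    by (simp add: positive_def)
  show "countably_additive (sets M)
          (\<lambda>B. ennreal t * emeasure M B + ennreal (1 - t) * emeasure N B)"
  proof (rule countably_additiveI)
    fix A :: "nat \<Rightarrow> 'a set"
    assume A: "range A \<subseteq> sets M" "disjoint_family A"
    have "(\<Sum>i. ennreal t * emeasure M (A i) + ennreal (1 - t) * emeasure N (A i))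
        = ennreal t * (\<Sum>i. emeasure M (A i)) + ennreal (1 - t) * (\<Sum>i. emeasure N (A i))"
      by (simp add: suminf_add [symmetric])
    then show "(\<Sum>i. ennreal t * emeasure M (A i) + ennreal (1 - t) * emeasure N (A i))
        = ennreal t * emeasure M (\<Union>i. A i) + ennreal (1 - t) * emeasure N (\<Union>i. A i)"
      using A assms(1) by (simp add: suminf_emeasure)
  qed
qed (fact B)

definition convex_class :: "'a measure set \<Rightarrow> bool" where
  "convex_class FF \<longleftrightarrow> (\<forall>M\<in>FF. \<forall>N\<in>FF. \<forall>t\<in>{0..1}. mixture t M N \<in> FF)"

definition class_integrable ::
    "(real ^ 'k) set \<Rightarrow> (real ^ 'd) measure set \<Rightarrow> (real ^ 'k \<Rightarrow> real ^ 'd \<Rightarrow> real ^ 'k) \<Rightarrow> bool" where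
  "class_integrable Act FF V \<longleftrightarrow>
     (\<forall>x\<in>Act. \<forall>F\<in>FF. \<forall>i. integrable F (\<lambda>y. V x y $ i))"

definition integrated ::
    "(real ^ 'k \<Rightarrow> real ^ 'd \<Rightarrow> real ^ 'k) \<Rightarrow> real ^ 'k \<Rightarrow> (real ^ 'd) measure \<Rightarrow> real ^ 'k" where
  "integrated V x F = (\<chi> i. \<integral>y. V x y $ i \<partial>F)"

definition identification_function ::
    "(real ^ 'k) set \<Rightarrow> (real ^ 'd) measure set \<Rightarrow> ((real ^ 'd) measure \<Rightarrow> (real ^ 'k) set) \<Rightarrow>
     (real ^ 'k \<Rightarrow> real ^ 'd \<Rightarrow> real ^ 'k) \<Rightarrow> bool" where
  "identification_function Act FF T V \<longleftrightarrow>
     class_integrable Act FF V \<and> (\<forall>x\<in>Act. \<forall>F\<in>FF. x \<in> T F \<longrightarrow> integrated V x F = 0)"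

definition strict_identification_function ::
    "(real ^ 'k) set \<Rightarrow> (real ^ 'd) measure set \<Rightarrow> ((real ^ 'd) measure \<Rightarrow> (real ^ 'k) set) \<Rightarrow>
     (real ^ 'k \<Rightarrow> real ^ 'd \<Rightarrow> real ^ 'k) \<Rightarrow> bool" where
  "strict_identification_function Act FF T V \<longleftrightarrow>
     class_integrable Act FF V \<and> (\<forall>x\<in>Act. \<forall>F\<in>FF. x \<in> T F \<longleftrightarrow> integrated V x F = 0)"

definition richness_condition ::
    "(real ^ 'k) set \<Rightarrow> (real ^ 'd) measure set \<Rightarrow> (real ^ 'k \<Rightarrow> real ^ 'd \<Rightarrow> real ^ 'k) \<Rightarrow> bool" where
  "richness_condition Act FF V \<longleftrightarrow>
     (\<forall>x\<in>interior Act. \<exists>G :: nat \<Rightarrow> (real ^ 'd) measure.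
        (\<forall>i\<in>{1..CARD('k) + 1}. G i \<in> FF) \<and>
        0 \<in> interior (convex hull ((\<lambda>i. integrated V x (G i)) ` {1..CARD('k) + 1})))"

(* Weak convergence of Borel probability measures on a topological space; the library notion
   weak_conv_m is confined to the real line. *)
definition weakly_converges :: "(nat \<Rightarrow> 'a::topological_space measure) \<Rightarrow> 'a measure \<Rightarrow> bool" where
  "weakly_converges M N \<longleftrightarrow>
     (\<forall>f :: 'a \<Rightarrow> real. continuous_on UNIV f \<and> bounded (range f) \<longrightarrow>
        (\<lambda>n. \<integral>z. f z \<partial>M n) \<longlonglongrightarrow> (\<integral>z. f z \<partial>N))"

definition measure_support :: "'a::topological_space measure \<Rightarrow> 'a set" where
  "measure_support M = {z. \<forall>U. open U \<and> z \<in> U \<longrightarrow> 0 < emeasure M U}"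

(* A distribution on a subset of R^d, regarded as a Borel measure on all of R^d. *)
definition extend_borel :: "(real ^ 'd) measure \<Rightarrow> (real ^ 'd) measure" where
  "extend_borel F = distr F borel (\<lambda>y. y)"

definition dirac_approximation :: "(real ^ 'd) measure set \<Rightarrow> bool" where
  "dirac_approximation FF \<longleftrightarrow>
     (\<forall>y. \<exists>(G :: nat \<Rightarrow> (real ^ 'd) measure) K.
        (\<forall>n. G n \<in> FF) \<and>
        weakly_converges (\<lambda>n. extend_borel (G n)) (return borel y) \<and>
        compact K \<and> (\<forall>n. measure_support (extend_borel (G n)) \<subseteq> K))"

(* The point y ranges over the whole space and not only over S, so that g is bounded on the part
   of S inside any compact set. For closed S this agrees with local boundedness of g as a map on
   the subspace S; for other S it is stronger. *)
definition locally_bounded_on :: "'a::topological_space set \<Rightarrow> ('a \<Rightarrow> 'b::metric_space) \<Rightarrow> bool" where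
  "locally_bounded_on S g \<longleftrightarrow> (\<forall>y. \<exists>U. open U \<and> y \<in> U \<and> bounded (g ` (U \<inter> S)))"

definition regularity_condition ::
    "(real ^ 'k) set \<Rightarrow> (real ^ 'd) set \<Rightarrow> (real ^ 'k \<Rightarrow> real ^ 'd \<Rightarrow> real ^ 'k) \<Rightarrow>
     (real ^ 'k \<Rightarrow> real ^ 'd \<Rightarrow> real ^ 'k) \<Rightarrow> bool" where
  "regularity_condition Act Obs V V' \<longleftrightarrow>
     (AE x in lebesgue. x \<in> interior Act \<longrightarrow>
        locally_bounded_on Obs (V x) \<and> locally_bounded_on Obs (V' x)) \<and>
     (interior Act \<times> Obs) -
       {(x, y) \<in> interior Act \<times> Obs.
          continuous (at y within Obs) (V x) \<and> continuous (at y within Obs) (V' x)}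
       \<in> null_sets lebesgue"

end

theory Submission
  imports Defs
begin

text \<open>
  Fix an interior point \<open>x\<close> of the action domain and let \<open>W\<close> be the set of all pairs of integrated
  values \<open>(integrated V x F, integrated V' x F)\<close>.  Integration against a mixture is the mixture of
  the integrals, so \<open>W\<close> is convex, and richness says that its first projection is a neighbourhood
  of \<open>0\<close>.  Strictness of \<open>V\<close> turns a pair \<open>(0, b)\<close> in \<open>W\<close> into a distribution whose functional
  value contains \<open>x\<close>, which forces \<open>b = 0\<close>.  A convex set with these properties lies in the
  graph of a linear map (\<open>convex_imp_linear_graph\<close>): mixing \<open>(a, b)\<close> with a pair over a small
  negative multiple of \<open>a\<close> lands over \<open>0\<close>, so \<open>W\<close> is symmetric up to scaling, its linear span
  consists of multiples of its points, and the first projection is injective on that span.  The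
  matrix of this linear map is \<open>h x\<close>.

  Regularity and continuity of \<open>h\<close> rest on such neighbourhoods of \<open>0\<close>.  If \<open>V'\<close> is rich, the
  range of \<open>h x\<close> has interior points, so \<open>h x\<close> is regular.  If the integrals are continuous, choose
  distributions whose integrated values at \<open>x0\<close> are proportional to the unit vectors; near \<open>x0\<close>
  they still determine \<open>h\<close> through a regular linear system with continuous data
  (\<open>continuous_on_matrix_if_values_continuous\<close>).  Under both assumptions the determinant is
  continuous without zeros, and so has constant sign on a connected interior.

  For the pointwise identity, integrate along distributions that approximate the Dirac measure at
  \<open>y\<close>.  Their supports lie in one compact set, and for almost all \<open>x\<close> the maps \<open>V x\<close> and
  \<open>V' x\<close> are bounded on the part of it inside the observation domain, so
  continuity at the single point \<open>y\<close> suffices for the integrals to converge to the values at \<open>y\<close>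
  (\<open>tendsto_integral_dirac\<close>), and the identity of the integrals passes to the limit.
\<close>

section \<open>Integrals with respect to mixtures\<close>

lemma nn_integral_mixture:
  assumes N: "sets N = sets M" and f: "f \<in> borel_measurable M"
  shows "(\<integral>\<^sup>+z. f z \<partial>mixture t M N)
    = ennreal t * (\<integral>\<^sup>+z. f z \<partial>M) + ennreal (1 - t) * (\<integral>\<^sup>+z. f z \<partial>N)"
  using f
proof (induction rule: borel_measurable_induct)
  case (cong f g)
  then have "(\<integral>\<^sup>+z. f z \<partial>P) = (\<integral>\<^sup>+z. g z \<partial>P)" if "sets P = sets M" for P
    using sets_eq_imp_space_eq[OF that] by (intro nn_integral_cong) auto
  then show ?case using cong N by simp
next
  case (set A)
  then show ?case using N by (simp add: emeasure_mixture)
next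
  case (mult u c)
  have "u \<in> borel_measurable N" "u \<in> borel_measurable (mixture t M N)"
    using mult(2) N by (simp_all cong: measurable_cong_sets)
  with mult show ?case by (simp add: nn_integral_cmult algebra_simps)
next
  case (add u v)
  have "w \<in> borel_measurable N" "w \<in> borel_measurable (mixture t M N)"
    if "w \<in> borel_measurable M" for w :: "'a \<Rightarrow> ennreal"
    using that N by (simp_all cong: measurable_cong_sets)
  note m = this[OF add(1)] this[OF add(3)]
  have sum: "(\<integral>\<^sup>+z. v z + u z \<partial>P) = (\<integral>\<^sup>+z. v z \<partial>P) + (\<integral>\<^sup>+z. u z \<partial>P)"
    if "P = M \<or> P = N \<or> P = mixture t M N" for P
    using that m add(1,3) by (auto intro: nn_integral_add)
  show ?case
    unfolding sum[OF disjI1[OF refl]] sum[OF disjI2[OF disjI1[OF refl]]]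
      sum[OF disjI2[OF disjI2[OF refl]]] add.IH distrib_left
    by (simp only: ac_simps)
next
  case (seq U)
  have m: "U i \<in> borel_measurable N" "U i \<in> borel_measurable (mixture t M N)" for i
    using seq(1)[of i] N by (simp_all cong: measurable_cong_sets)
  have inc: "incseq (\<lambda>i. c * (\<integral>\<^sup>+z. U i z \<partial>P))" for c :: ennreal and P
    using seq(3) by (auto simp: incseq_def le_fun_def intro!: mult_left_mono nn_integral_mono)
  have sup: "(\<integral>\<^sup>+z. (SUP i. U i) z \<partial>P) = (SUP i. \<integral>\<^sup>+z. U i z \<partial>P)"
    if "\<And>i. U i \<in> borel_measurable P" for P
    using nn_integral_monotone_convergence_SUP[OF seq(3) that] by (simp add: image_comp)
  show ?case
    using seq m inc
    by (simp add: sup SUP_mult_left_ennreal ennreal_SUP_add del: Sup_apply SUP_apply)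
qed

lemma integral_mixture:
  fixes f :: "'a \<Rightarrow> real"
  assumes N: "sets N = sets M" and t: "t \<in> {0..1}"
    and fM: "integrable M f" and fN: "integrable N f"
  shows "(\<integral>z. f z \<partial>mixture t M N) = t * (\<integral>z. f z \<partial>M) + (1 - t) * (\<integral>z. f z \<partial>N)"
proof -
  have m: "f \<in> borel_measurable M" using fM by simp
  have mm: "f \<in> borel_measurable (mixture t M N)"
    using m by (simp cong: measurable_cong_sets)
  have fin: "(\<integral>\<^sup>+z. ennreal (f z) \<partial>P) < \<infinity>" "(\<integral>\<^sup>+z. ennreal (- f z) \<partial>P) < \<infinity>"
    if "integrable P f" for P
    using that by (auto simp: real_integrable_def less_top[symmetric])
  have nn: "(\<integral>\<^sup>+z. g z \<partial>mixture t M N)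
      = ennreal t * (\<integral>\<^sup>+z. g z \<partial>M) + ennreal (1 - t) * (\<integral>\<^sup>+z. g z \<partial>N)"
    if "g \<in> borel_measurable M" for g
    using nn_integral_mixture[OF N that] .
  have pos: "enn2real (\<integral>\<^sup>+z. g z \<partial>mixture t M N)
      = t * enn2real (\<integral>\<^sup>+z. g z \<partial>M) + (1 - t) * enn2real (\<integral>\<^sup>+z. g z \<partial>N)"
    "(\<integral>\<^sup>+z. g z \<partial>mixture t M N) < \<infinity>"
    if "g \<in> borel_measurable M" "(\<integral>\<^sup>+z. g z \<partial>M) < \<infinity>" "(\<integral>\<^sup>+z. g z \<partial>N) < \<infinity>" for g
    using that t by (auto simp: nn enn2real_plus enn2real_mult ennreal_mult_less_top)
  have "integrable (mixture t M N) f"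
    using mm pos(2)[of "\<lambda>z. ennreal (f z)"] pos(2)[of "\<lambda>z. ennreal (- f z)"] fin[OF fM] fin[OF fN] m
    by (auto simp: real_integrable_def)
  then show ?thesis
    using fM fN pos(1)[of "\<lambda>z. ennreal (f z)"] pos(1)[of "\<lambda>z. ennreal (- f z)"]
      fin[OF fM] fin[OF fN] m
    by (simp add: real_lebesgue_integral_def algebra_simps)
qed

section \<open>Convex sets inside the graph of a linear map\<close>

text \<open>
  Convexity makes the cone over \<open>W\<close> closed under addition, and symmetry up to positive factors
  makes it closed under negative multiples; so the cone is already a subspace.
\<close>

lemma span_subset_cone_if_convex_symmetric:
  fixes W :: "'a::real_vector set"
  assumes W: "convex W" "W \<noteq> {}"
    and sym: "\<And>w. w \<in> W \<Longrightarrow> \<exists>t>0. - t *\<^sub>R w \<in> W"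
  shows "span W \<subseteq> {s *\<^sub>R w |s w. 0 \<le> s \<and> w \<in> W}"
proof (rule span_minimal)
  let ?C = "{s *\<^sub>R w |s w. 0 \<le> s \<and> w \<in> W}"
  show "W \<subseteq> ?C"
    by (force intro: exI[of _ 1])
  show "subspace ?C"
  proof (rule subspaceI)
    obtain w where "w \<in> W" using W by auto
    then show "0 \<in> ?C"
      by (force intro: exI[of _ 0])
  next
    fix x y assume "x \<in> ?C" "y \<in> ?C"
    then obtain r s v w where *: "x = r *\<^sub>R v" "y = s *\<^sub>R w" "0 \<le> r" "0 \<le> s" "v \<in> W" "w \<in> W"
      by blast
    show "x + y \<in> ?C"
    proof (cases "r + s = 0")
      case True
      with * have "r = 0" "s = 0" by auto
      with * show ?thesis by force
    next
      case False
      with * have "r + s > 0" by auto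
      then have "(r / (r + s)) *\<^sub>R v + (s / (r + s)) *\<^sub>R w \<in> W"
        using * W(1) by (intro convexD) (auto simp: add_divide_distrib[symmetric])
      moreover have "x + y = (r + s) *\<^sub>R ((r / (r + s)) *\<^sub>R v + (s / (r + s)) *\<^sub>R w)"
        using * \<open>r + s > 0\<close> by (simp add: scaleR_add_right)
      ultimately show ?thesis
        using \<open>r + s > 0\<close> by (metis (mono_tags, lifting) less_imp_le mem_Collect_eq)
    qed
  next
    fix c :: real and x assume "x \<in> ?C"
    then obtain s w where *: "x = s *\<^sub>R w" "0 \<le> s" "w \<in> W"
      by blast
    show "c *\<^sub>R x \<in> ?C"
    proof (cases "0 \<le> c")
      case True
      with * show ?thesis
        by (force intro: exI[of _ "c * s"])
    next
      case False
      obtain t where t: "t > 0" "- t *\<^sub>R w \<in> W" using sym * by blast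
      have "c *\<^sub>R x = (- c * s / t) *\<^sub>R (- t *\<^sub>R w)" "0 \<le> - c * s / t"
        using t * False by (auto simp: divide_nonpos_pos mult_nonpos_nonneg)
      with t show ?thesis by blast
    qed
  qed
qed

text \<open>
  The convex combination of \<open>(a, b)\<close> and \<open>(- t a, c)\<close> whose first component vanishes has a
  vanishing second component, so \<open>c = - t b\<close>.  Thus \<open>W\<close> is symmetric up to scaling and its span is
  the cone over \<open>W\<close>.  The fibre condition extends from \<open>W\<close> to this cone, so that \<open>fst\<close> is injective
  on the span; its linear left inverse followed by \<open>snd\<close> is the required map.
\<close>

lemma convex_imp_linear_graph:
  fixes W :: "('a::real_normed_vector \<times> 'b::real_vector) set"
  assumes W: "convex W" and int: "0 \<in> interior (fst ` W)"
    and fib: "\<And>b. (0, b) \<in> W \<Longrightarrow> b = 0"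
  obtains g where "linear g" "\<And>a b. (a, b) \<in> W \<Longrightarrow> b = g a"
proof -
  obtain e where e: "e > 0" "ball 0 e \<subseteq> fst ` W"
    using int by (auto simp: mem_interior)
  have sym: "\<exists>t>0. - t *\<^sub>R w \<in> W" if w: "w \<in> W" for w
  proof -
    obtain a b where ab: "w = (a, b)" by (cases w)
    \<comment> \<open>small enough for \<open>- t a\<close> to lie in the ball of radius \<open>e\<close>, also when \<open>a = 0\<close>\<close>
    define t where "t = e / (norm a + 1)"
    have t: "t > 0" using e by (simp add: t_def add_nonneg_pos)
    have "e * norm a < e * (norm a + 1)" using e by simp
    then have "e * norm a / (norm a + 1) < e"
      by (subst pos_divide_less_eq) (simp_all add: add_nonneg_pos)
    then have "norm (- t *\<^sub>R a) < e"
      using e by (simp add: t_def)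
    then have "- t *\<^sub>R a \<in> fst ` W"
      using e by (auto simp: subset_iff)
    then obtain c where c: "(- t *\<^sub>R a, c) \<in> W" by force
    have "(1 / (1 + t)) *\<^sub>R (- t *\<^sub>R a, c) + (t / (1 + t)) *\<^sub>R w \<in> W"
      using c w t W by (intro convexD) (auto simp: add_divide_distrib[symmetric])
    then have "(1 / (1 + t)) *\<^sub>R c + (t / (1 + t)) *\<^sub>R b = 0"
      by (intro fib) (simp add: ab)
    then have "(1 / (1 + t)) *\<^sub>R (c + t *\<^sub>R b) = 0"
      by (simp add: scaleR_add_right)
    then have "c + t *\<^sub>R b = 0"
      using t by simp
    then have "c = - t *\<^sub>R b"
      by (simp add: eq_neg_iff_add_eq_0)
    with c t show ?thesis by (auto simp: ab)
  qed
  have "0 \<in> fst ` W" using int interior_subset by blast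
  then have "W \<noteq> {}" by auto
  from span_subset_cone_if_convex_symmetric[OF W this sym]
  have cone: "span W \<subseteq> {s *\<^sub>R w |s w. 0 \<le> s \<and> w \<in> W}" .
  have lin: "linear (fst :: 'a \<times> 'b \<Rightarrow> 'a)"
    by (simp add: linear_iff)
  have "inj_on fst (span W)"
  proof (subst linear_inj_on_iff_eq_0[OF lin subspace_span], intro ballI impI)
    fix x assume x: "x \<in> span W" "fst x = 0"
    then obtain s w where s: "x = s *\<^sub>R w" "w \<in> W" using cone by blast
    show "x = 0"
    proof (cases "s = 0")
      case False
      with x s have w: "fst w = 0" by simp
      then have "w = (0, snd w)" by (simp add: prod_eq_iff)
      with s fib[of "snd w"] have "snd w = 0" by simp
      with w have "w = 0" by (simp add: prod_eq_iff)
      with s show ?thesis by simp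
    qed (use s in simp)
  qed
  then obtain g where g: "linear g" "\<And>v. v \<in> span W \<Longrightarrow> g (fst v) = v"
    using linear_exists_left_inverse_on[OF lin subspace_span] by blast
  show thesis
  proof
    show "linear (snd \<circ> g)"
      by (intro linear_compose g) (simp add: linear_iff)
    show "b = (snd \<circ> g) a" if "(a, b) \<in> W" for a b
      using g(2)[of "(a, b)"] that by (simp add: span_base)
  qed
qed

section \<open>Determinants and linear systems\<close>

lemma tendsto_det:
  fixes A :: "'a \<Rightarrow> real ^ 'n ^ 'n"
  assumes "(A \<longlongrightarrow> L) F"
  shows "((\<lambda>x. det (A x)) \<longlongrightarrow> det L) F"
  unfolding det_def using assms by (intro tendsto_intros)

text \<open>
  Cramer's rule writes the solution as a continuous function of the matrix and the right-hand side
  wherever the determinant does not vanish.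
\<close>

lemma tendsto_linear_system_solution:
  fixes A :: "'a \<Rightarrow> real ^ 'n ^ 'n"
  assumes A: "(A \<longlongrightarrow> A0) F" and b: "(b \<longlongrightarrow> b0) F" and nz: "det A0 \<noteq> 0"
    and u: "\<forall>\<^sub>F x in F. A x *v u x = b x" and u0: "A0 *v u0 = b0"
  shows "(u \<longlongrightarrow> u0) F"
proof -
  let ?sol = "\<lambda>A b. \<chi> k. det (\<chi> i j. if j = k then b $ i else A $ i $ j) / det A"
  have "\<forall>\<^sub>F x in F. det (A x) \<noteq> 0"
    using tendsto_imp_eventually_ne[OF tendsto_det[OF A] nz] .
  with u have "\<forall>\<^sub>F x in F. ?sol (A x) (b x) = u x"
    by eventually_elim (simp add: cramer)
  moreover have "((\<lambda>x. ?sol (A x) (b x)) \<longlongrightarrow> ?sol A0 b0) F"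
  proof (intro tendsto_vec_lambda tendsto_divide tendsto_det A nz)
    fix i j k
    show "((\<lambda>x. if j = k then b x $ i else A x $ i $ j) \<longlongrightarrow> (if j = k then b0 $ i else A0 $ i $ j)) F"
      using A b by (auto intro!: tendsto_intros)
  qed
  moreover have "?sol A0 b0 = u0"
    using cramer[OF nz] u0 by auto
  ultimately show ?thesis
    using tendsto_cong by fastforce
qed

lemma det_nonzero_if_range_has_interior:
  fixes A :: "real ^ 'n ^ 'n"
  assumes S: "S \<subseteq> range ((*v) A)" and int: "interior S \<noteq> {}"
  shows "det A \<noteq> 0"
proof -
  have "subspace (range ((*v) A))"
    by (intro linear_subspace_image subspace_UNIV) simp
  then have "span S \<subseteq> range ((*v) A)"
    using S by (rule span_minimal[rotated])
  moreover have "span S = UNIV"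
    using empty_interior_lowdim[of S] int dim_subset_UNIV[of S]
    by (metis dim_eq_full linorder_neqE_nat not_le)
  ultimately have "surj ((*v) A)" by auto
  then show ?thesis
    using matrix_right_invertible_surjective invertible_right_inverse invertible_det_nz by metis
qed

section \<open>Approximation of Dirac measures\<close>

text \<open>
  The complement of the support is the union of all open null sets, and by the Lindelof property
  countably many of them cover it.
\<close>

lemma null_sets_complement_measure_support:
  fixes M :: "'a::second_countable_topology measure"
  assumes M: "sets M = sets borel"
  shows "- measure_support M \<in> null_sets M"
proof -
  define U where "U = {U :: 'a set. open U \<and> emeasure M U = 0}"
  have U: "- measure_support M = \<Union>U"
    by (auto simp: measure_support_def U_def)
  obtain U' where U': "U' \<subseteq> U" "countable U'" "\<Union>U' = \<Union>U"
    using Lindelof[of U] by (auto simp: U_def)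
  have "(\<Union>S\<in>U'. S) \<in> null_sets M"
    using U' M by (intro null_sets_UN') (auto simp: U_def null_sets_def)
  with U U' show ?thesis by simp
qed

lemma compact_locally_bounded_imp_bounded:
  assumes K: "compact K" and g: "locally_bounded_on S g"
  shows "bounded (g ` (K \<inter> S))"
proof -
  define C where "C = {U. open U \<and> bounded (g ` (U \<inter> S))}"
  have "K \<subseteq> \<Union>C"
    using g by (auto simp: C_def locally_bounded_on_def)
  then obtain D where D: "D \<subseteq> C" "finite D" "K \<subseteq> \<Union>D"
    by (rule compactE[OF K]) (auto simp: C_def)
  have "g ` (K \<inter> S) \<subseteq> (\<Union>U\<in>D. g ` (U \<inter> S))"
    using D(3) by auto
  moreover have "bounded (\<Union>U\<in>D. g ` (U \<inter> S))"
    using D(1,2) by (intro bounded_UN) (auto simp: C_def)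
  ultimately show ?thesis
    by (rule bounded_subset[rotated])
qed

text \<open>
  The function \<open>g\<close> need not be continuous away from \<open>y\<close>, so weak convergence cannot be applied to it
  directly.  Instead \<open>g - g y\<close> is dominated, almost everywhere, by a small constant plus a multiple
  of a continuous bounded function that vanishes at \<open>y\<close> and equals \<open>1\<close> away from \<open>y\<close>; the integrals
  of the latter tend to \<open>0\<close>.
\<close>

lemma tendsto_integral_dirac:
  fixes g :: "real ^ 'd \<Rightarrow> real"
  assumes G: "\<And>n. distribution_on Obs (G n)"
    and weak: "weakly_converges (\<lambda>n. extend_borel (G n)) (return borel y)"
    and K: "compact K" "\<And>n. measure_support (extend_borel (G n)) \<subseteq> K"
    and int: "\<And>n. integrable (G n) g"
    and y: "y \<in> Obs" and cont: "continuous (at y within Obs) g"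
    and lb: "locally_bounded_on Obs g"
  shows "(\<lambda>n. \<integral>z. g z \<partial>G n) \<longlonglongrightarrow> g y"
proof (rule tendstoI)
  fix e :: real assume e: "e > 0"
  have prob: "prob_space (G n)" for n
    using G by (simp add: distribution_on_def)
  have space: "space (G n) = Obs" for n
    using G[of n] sets_eq_imp_space_eq[of "G n" "restrict_space borel Obs"]
    by (simp add: distribution_on_def space_restrict_space)
  have id: "(\<lambda>z. z) \<in> measurable (G n) borel" for n
  proof -
    have "(\<lambda>z. z) \<in> measurable (restrict_space borel Obs) (borel :: (real ^ 'd) measure)"
      by (intro measurable_restrict_space1) simp
    then show ?thesis
      using G[of n] by (simp add: distribution_on_def cong: measurable_cong_sets)
  qed
  have inK: "AE z in G n. z \<in> K" for n
  proof -
    have "AE z in extend_borel (G n). z \<in> K"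
      using null_sets_complement_measure_support[of "extend_borel (G n)"] K(2)[of n]
      by (intro AE_I'[of "- measure_support (extend_borel (G n))"]) (auto simp: extend_borel_def)
    then show ?thesis
      unfolding extend_borel_def by (rule AE_distrD[OF id])
  qed
  obtain B where B: "\<And>z. z \<in> K \<inter> Obs \<Longrightarrow> \<bar>g z\<bar> \<le> B"
    using compact_locally_bounded_imp_bounded[OF K(1) lb] by (auto simp: bounded_iff)
  \<comment> \<open>a bound for the oscillation \<open>g z - g y\<close>; the term for \<open>y\<close> is there because \<open>y\<close> may lie
    outside \<open>K\<close>\<close>
  define c where "c = \<bar>B\<bar> + \<bar>g y\<bar>"
  obtain d where d: "d > 0" "\<And>z. z \<in> Obs \<Longrightarrow> dist z y < d \<Longrightarrow> \<bar>g z - g y\<bar> < e / 2"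
    using cont[unfolded continuous_within_eps_delta dist_real_def, rule_format, of "e / 2"] e
    by auto
  define f where "f z = min 1 (dist z y / d)" for z
  have f: "0 \<le> f z" "f z \<le> 1" for z using d by (auto simp: f_def)
  have fc: "continuous_on UNIV f" unfolding f_def using d(1) by (intro continuous_intros) auto
  have fm: "f \<in> borel_measurable borel"
    using fc by (rule borel_measurable_continuous_onI)
  have "bounded (range f)"
    using f by (auto simp: bounded_iff intro!: exI[of _ 1])
  then have "(\<lambda>n. \<integral>z. f z \<partial>extend_borel (G n)) \<longlonglongrightarrow> (\<integral>z. f z \<partial>return borel y)"
    using weak fc by (simp add: weakly_converges_def)
  moreover have "(\<integral>z. f z \<partial>return borel y) = 0"
    using integral_return[of y borel f] fm by (simp add: f_def)
  ultimately have "(\<lambda>n. \<integral>z. f z \<partial>G n) \<longlonglongrightarrow> 0"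
    using id fm by (simp add: extend_borel_def integral_distr)
  then have "(\<lambda>n. e / 2 + c * (\<integral>z. f z \<partial>G n)) \<longlonglongrightarrow> e / 2 + c * 0"
    by (intro tendsto_intros)
  then have "\<forall>\<^sub>F n in sequentially. e / 2 + c * (\<integral>z. f z \<partial>G n) < e"
    using e by (auto intro: order_tendstoD)
  then show "\<forall>\<^sub>F n in sequentially. dist (\<integral>z. g z \<partial>G n) (g y) < e"
  proof eventually_elim
    case (elim n)
    interpret prob_space "G n" by (rule prob)
    have fi: "integrable (G n) f"
      using f by (intro integrable_const_bound[of _ 1] measurable_compose[OF id fm] AE_I2) auto
    have gi: "integrable (G n) (\<lambda>z. g z - g y)"
      using int by auto
    have "\<bar>(\<integral>z. g z \<partial>G n) - g y\<bar> = \<bar>\<integral>z. g z - g y \<partial>G n\<bar>"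
      using int by (simp add: prob_space)
    also have "\<dots> \<le> (\<integral>z. \<bar>g z - g y\<bar> \<partial>G n)"
      by (rule integral_abs_bound)
    also have "\<dots> \<le> (\<integral>z. e / 2 + c * f z \<partial>G n)"
    proof (rule integral_mono_AE)
      show "AE z in G n. \<bar>g z - g y\<bar> \<le> e / 2 + c * f z"
        using inK[of n] AE_space
      proof eventually_elim
        case (elim z)
        then have z: "z \<in> Obs" "\<bar>g z\<bar> \<le> B" using space B by auto
        show ?case
        proof (cases "dist z y < d")
          case True
          have "0 \<le> c * f z" using f by (simp add: c_def)
          with d(2)[OF z(1) True] show ?thesis by linarith
        next
          case False
          then have "f z = 1" using d(1) by (simp add: f_def)
          with z e show ?thesis by (simp add: c_def)
        qed
      qed
    qed (use fi gi in auto)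
    also have "\<dots> = e / 2 + c * (\<integral>z. f z \<partial>G n)"
      using fi by (simp add: prob_space)
    finally show ?case using elim by (simp add: dist_real_def)
  qed
qed

section \<open>Null sets in a product space\<close>

lemma AE_lborel_fst:
  assumes "AE x in (lborel :: 'a::euclidean_space measure). P x"
  shows "AE z in (lborel :: ('a \<times> 'b::euclidean_space) measure). P (fst z)"
proof -
  obtain N where N: "N \<in> null_sets lborel" "{x. \<not> P x} \<subseteq> N"
    using assms by (auto simp: eventually_ae_filter)
  have "emeasure (lborel \<Otimes>\<^sub>M lborel) (N \<times> (UNIV :: 'b set)) = 0"
    using N by (subst lborel.emeasure_pair_measure_Times) auto
  moreover have "N \<times> (UNIV :: 'b set) \<in> sets (lborel \<Otimes>\<^sub>M lborel)"
    using N by (intro pair_measureI) auto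
  ultimately have "N \<times> (UNIV :: 'b set) \<in> null_sets (lborel \<Otimes>\<^sub>M lborel)"
    by (rule null_setsI)
  then have "N \<times> (UNIV :: 'b set) \<in> null_sets lborel"
    by (simp only: lborel_prod)
  then show ?thesis
    by (rule AE_I') (use N in auto)
qed

section \<open>The matrix relating two identification functions\<close>

lemma integrated_matrix_mult:
  assumes "\<And>i. integrable F (\<lambda>y. V x y $ i)"
  shows "integrated (\<lambda>x y. h x *v V x y) x F = h x *v integrated V x F"
  using assms by (simp add: integrated_def matrix_vector_mult_def vec_eq_iff)

lemma strict_identification_function_matrix_mult:
  assumes V: "strict_identification_function Act FF T V"
    and h: "\<And>x. x \<in> Act \<Longrightarrow> det (h x) \<noteq> 0"
  shows "strict_identification_function Act FF T (\<lambda>x y. h x *v V x y)"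
proof -
  have V: "class_integrable Act FF V"
    "\<And>x F. x \<in> Act \<Longrightarrow> F \<in> FF \<Longrightarrow> x \<in> T F \<longleftrightarrow> integrated V x F = 0"
    using V by (auto simp: strict_identification_function_def)
  have "class_integrable Act FF (\<lambda>x y. h x *v V x y)"
    using V(1) by (auto simp: class_integrable_def matrix_vector_mult_def)
  moreover have "x \<in> T F \<longleftrightarrow> integrated (\<lambda>x y. h x *v V x y) x F = 0"
    if x: "x \<in> Act" and F: "F \<in> FF" for x F
  proof -
    have "integrated (\<lambda>x y. h x *v V x y) x F = h x *v integrated V x F"
      using V(1) x F by (intro integrated_matrix_mult) (auto simp: class_integrable_def)
    moreover have "h x *v v = 0 \<longleftrightarrow> v = 0" for v
      using h[OF x]
      by (metis invertible_det_nz invertible_def matrix_left_invertible_ker matrix_vector_mult_0_right)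
    ultimately show ?thesis using V(2)[OF x F] by simp
  qed
  ultimately show ?thesis by (simp add: strict_identification_function_def)
qed

lemma integrated_mixture:
  assumes "class_integrable Act FF V" "x \<in> Act" "M \<in> FF" "N \<in> FF" "sets N = sets M" "t \<in> {0..1}"
  shows "integrated V x (mixture t M N) = t *\<^sub>R integrated V x M + (1 - t) *\<^sub>R integrated V x N"
  using assms by (auto simp: integrated_def class_integrable_def vec_eq_iff integral_mixture)

lemma convex_integrated_pairs:
  fixes V V' :: "real ^ 'k \<Rightarrow> real ^ 'd \<Rightarrow> real ^ 'k"
  assumes V: "class_integrable Act FF V" and V': "class_integrable Act FF V'" and x: "x \<in> Act"
    and sets: "\<And>M N. M \<in> FF \<Longrightarrow> N \<in> FF \<Longrightarrow> sets N = sets M" and FF: "convex_class FF"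
  shows "convex ((\<lambda>F. (integrated V x F, integrated V' x F)) ` FF)"
proof (rule convexI, clarify)
  fix M N and u v :: real
  assume MN: "M \<in> FF" "N \<in> FF" and uv: "0 \<le> u" "0 \<le> v" "u + v = 1"
  then have v: "v = 1 - u" and u: "u \<in> {0..1}" by auto
  have "mixture u M N \<in> FF" using FF MN u by (simp add: convex_class_def)
  moreover have "u *\<^sub>R (integrated V x M, integrated V' x M) + v *\<^sub>R (integrated V x N, integrated V' x N)
      = (integrated V x (mixture u M N), integrated V' x (mixture u M N))"
    by (simp add: v integrated_mixture[OF V x MN sets[OF MN] u]
        integrated_mixture[OF V' x MN sets[OF MN] u])
  ultimately show "u *\<^sub>R (integrated V x M, integrated V' x M) + v *\<^sub>R (integrated V x N, integrated V' x N)
      \<in> (\<lambda>F. (integrated V x F, integrated V' x F)) ` FF"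
    by auto
qed

text \<open>
  The set of all integrated values is convex, so it contains the convex hull that the richness
  condition speaks of.
\<close>

lemma richness_imp_interior_integrated:
  fixes V :: "real ^ 'k \<Rightarrow> real ^ 'd \<Rightarrow> real ^ 'k"
  assumes V: "class_integrable Act FF V"
    and sets: "\<And>M N. M \<in> FF \<Longrightarrow> N \<in> FF \<Longrightarrow> sets N = sets M" and FF: "convex_class FF"
    and rich: "richness_condition Act FF V" and x: "x \<in> interior Act"
  shows "0 \<in> interior (integrated V x ` FF)"
proof -
  obtain G :: "nat \<Rightarrow> (real ^ 'd) measure" where G: "\<And>i. i \<in> {1..CARD('k) + 1} \<Longrightarrow> G i \<in> FF"
    "0 \<in> interior (convex hull ((\<lambda>i. integrated V x (G i)) ` {1..CARD('k) + 1}))"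
    using rich x unfolding richness_condition_def by blast
  have "x \<in> Act" using x interior_subset by blast
  from convex_linear_image[OF linear_fst convex_integrated_pairs[OF V V this sets FF]]
  have "convex (integrated V x ` FF)"
    by (simp add: image_image)
  then have "convex hull ((\<lambda>i. integrated V x (G i)) ` {1..CARD('k) + 1}) \<subseteq> integrated V x ` FF"
    using G(1) by (intro hull_minimal) auto
  with G(2) show ?thesis using interior_mono by blast
qed

text \<open>
  A pair \<open>(0, b)\<close> of integrated values comes from some \<open>F\<close> with \<open>x \<in> T F\<close>, because \<open>V\<close> is strict;
  then \<open>b = 0\<close>, because \<open>V'\<close> identifies \<open>T\<close>.
\<close>

lemma identification_functions_matrix:
  fixes V V' :: "real ^ 'k \<Rightarrow> real ^ 'd \<Rightarrow> real ^ 'k"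
  assumes V: "strict_identification_function Act FF T V" and V': "identification_function Act FF T V'"
    and sets: "\<And>M N. M \<in> FF \<Longrightarrow> N \<in> FF \<Longrightarrow> sets N = sets M" and FF: "convex_class FF"
    and rich: "richness_condition Act FF V" and x: "x \<in> interior Act"
  shows "\<exists>H. \<forall>F\<in>FF. integrated V' x F = H *v integrated V x F"
proof -
  let ?W = "(\<lambda>F. (integrated V x F, integrated V' x F)) ` FF"
  have xA: "x \<in> Act" using x interior_subset by blast
  have int: "class_integrable Act FF V" "class_integrable Act FF V'"
    using V V' by (auto simp: strict_identification_function_def identification_function_def)
  have "0 \<in> interior (fst ` ?W)"
    using richness_imp_interior_integrated[OF int(1) sets FF rich x] by (simp add: image_image)
  moreover have "b = 0" if "(0, b) \<in> ?W" for b
    using that V V' xA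
    by (auto simp: strict_identification_function_def identification_function_def)
  ultimately obtain g where g: "linear g" "\<And>a b. (a, b) \<in> ?W \<Longrightarrow> b = g a"
    using convex_imp_linear_graph[OF convex_integrated_pairs[OF int xA sets FF]] by blast
  have "integrated V' x F = matrix g *v integrated V x F" if "F \<in> FF" for F
    using g(2)[of "integrated V x F" "integrated V' x F"] that
      fun_cong[OF matrix_vector_mul(2)[OF g(1)]] by auto
  then show ?thesis by blast
qed

text \<open>
  The parameters \<open>F j\<close> with \<open>v x0 (F j)\<close> proportional to the unit vectors give, for every row of
  \<open>h x\<close>, a linear system with the vectors \<open>v x (F j)\<close> as rows of its matrix.  That matrix is diagonal
  and regular at \<open>x0\<close>.
\<close>

lemma continuous_on_matrix_if_values_continuous:
  fixes v w :: "'x::topological_space \<Rightarrow> 'f \<Rightarrow> real ^ 'k" and h :: "'x \<Rightarrow> real ^ 'k ^ 'k"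
  assumes eq: "\<And>x F. x \<in> S \<Longrightarrow> F \<in> FF \<Longrightarrow> w x F = h x *v v x F"
    and int: "\<And>x. x \<in> S \<Longrightarrow> 0 \<in> interior (v x ` FF)"
    and v: "\<And>F. F \<in> FF \<Longrightarrow> continuous_on S (\<lambda>x. v x F)"
    and w: "\<And>F. F \<in> FF \<Longrightarrow> continuous_on S (\<lambda>x. w x F)"
  shows "continuous_on S h"
  unfolding continuous_on_def
proof
  fix x0 assume x0: "x0 \<in> S"
  obtain e where e: "e > 0" "ball 0 e \<subseteq> v x0 ` FF"
    using int[OF x0] by (auto simp: mem_interior)
  have "\<exists>F\<in>FF. v x0 F = axis j (e / 2)" for j
  proof -
    have "axis j (e / 2) \<in> ball (0 :: real ^ 'k) e" using e(1)
      by (simp add: norm_eq_sqrt_inner inner_axis_axis real_sqrt_divide)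
    then show ?thesis using e(2) by force
  qed
  then obtain F where F: "\<And>j. F j \<in> FF" "\<And>j. v x0 (F j) = axis j (e / 2)" by metis
  define A where "A x = (\<chi> j. v x (F j))" for x
  have A: "(A \<longlongrightarrow> A x0) (at x0 within S)"
    unfolding A_def using v[OF F(1)] x0
    by (intro tendsto_vec_lambda) (simp add: continuous_on_def)
  have "det (A x0) = (\<Prod>j\<in>UNIV. A x0 $ j $ j)"
    by (rule det_diagonal) (simp add: A_def F(2) axis_def)
  then have nz: "det (A x0) \<noteq> 0"
    using e(1) by (simp add: A_def F(2) axis_def)
  show "(h \<longlongrightarrow> h x0) (at x0 within S)"
  proof (rule vec_tendstoI)
    fix i
    let ?b = "\<lambda>x. \<chi> j. w x (F j) $ i"
    have row: "A x *v (h x $ i) = ?b x" if "x \<in> S" for x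
      using eq[OF that F(1)]
      by (simp add: A_def vec_eq_iff matrix_vector_mult_def mult.commute)
    have b: "(?b \<longlongrightarrow> ?b x0) (at x0 within S)"
      using w[OF F(1)] x0 by (auto simp: continuous_on_def intro!: tendsto_vec_lambda tendsto_vec_nth)
    show "((\<lambda>x. h x $ i) \<longlongrightarrow> h x0 $ i) (at x0 within S)"
      by (rule tendsto_linear_system_solution[OF A b nz _ row[OF x0]])
        (auto simp: eventually_at_filter row)
  qed
qed

lemma det_constant_sign:
  fixes h :: "'x::topological_space \<Rightarrow> real ^ 'k ^ 'k"
  assumes S: "connected S" and h: "continuous_on S h" and nz: "\<And>x. x \<in> S \<Longrightarrow> det (h x) \<noteq> 0"
  shows "(\<forall>x\<in>S. 0 < det (h x)) \<or> (\<forall>x\<in>S. det (h x) < 0)"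
proof (rule ccontr)
  assume "\<not> ?thesis"
  then obtain x y where xy: "x \<in> S" "det (h x) \<le> 0" "y \<in> S" "0 \<le> det (h y)"
    by (auto simp: not_less)
  have "connected ((\<lambda>x. det (h x)) ` S)"
    using S h by (intro connected_continuous_image) (auto simp: continuous_on_def intro: tendsto_det)
  then have "0 \<in> (\<lambda>x. det (h x)) ` S"
    using xy connectedD_interval[of "(\<lambda>x. det (h x)) ` S" "det (h x)" "det (h y)" 0] by auto
  then show False using nz by auto
qed

lemma tendsto_integrated_dirac:
  fixes V :: "real ^ 'k \<Rightarrow> real ^ 'd \<Rightarrow> real ^ 'k"
  assumes G: "\<And>n. distribution_on Obs (G n)"
    and weak: "weakly_converges (\<lambda>n. extend_borel (G n)) (return borel y)"
    and K: "compact K" "\<And>n. measure_support (extend_borel (G n)) \<subseteq> K"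
    and int: "\<And>n i. integrable (G n) (\<lambda>z. V x z $ i)"
    and y: "y \<in> Obs" and cont: "continuous (at y within Obs) (V x)"
    and lb: "locally_bounded_on Obs (V x)"
  shows "(\<lambda>n. integrated V x (G n)) \<longlonglongrightarrow> V x y"
proof (rule vec_tendstoI)
  fix i
  have "continuous (at y within Obs) (\<lambda>z. V x z $ i)"
    by (rule bounded_linear.continuous[OF bounded_linear_vec_nth cont])
  moreover have "locally_bounded_on Obs (\<lambda>z. V x z $ i)"
    unfolding locally_bounded_on_def
  proof
    fix p
    obtain U where U: "open U" "p \<in> U" "bounded (V x ` (U \<inter> Obs))"
      using lb unfolding locally_bounded_on_def by blast
    have "bounded ((\<lambda>z. V x z $ i) ` (U \<inter> Obs))"
      using bounded_linear_image[OF U(3) bounded_linear_vec_nth[of i]] by (simp only: image_image)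
    with U show "\<exists>U. open U \<and> p \<in> U \<and> bounded ((\<lambda>z. V x z $ i) ` (U \<inter> Obs))"
      by blast
  qed
  ultimately have "(\<lambda>n. \<integral>z. V x z $ i \<partial>G n) \<longlonglongrightarrow> V x y $ i"
    by (intro tendsto_integral_dirac[OF G weak K int y])
  then show "(\<lambda>n. integrated V x (G n) $ i) \<longlonglongrightarrow> V x y $ i"
    by (simp add: integrated_def)
qed

lemma integrated_identity_at_dirac:
  fixes V V' :: "real ^ 'k \<Rightarrow> real ^ 'd \<Rightarrow> real ^ 'k"
  assumes dist: "\<And>F. F \<in> FF \<Longrightarrow> distribution_on Obs F"
    and dirac: "dirac_approximation FF"
    and int: "class_integrable Act FF V" "class_integrable Act FF V'" and x: "x \<in> Act"
    and eq: "\<And>F. F \<in> FF \<Longrightarrow> integrated V' x F = H *v integrated V x F"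
    and y: "y \<in> Obs"
    and cont: "continuous (at y within Obs) (V x)" "continuous (at y within Obs) (V' x)"
    and lb: "locally_bounded_on Obs (V x)" "locally_bounded_on Obs (V' x)"
  shows "V' x y = H *v V x y"
proof -
  obtain G K where G: "\<And>n. G n \<in> FF"
    and weak: "weakly_converges (\<lambda>n. extend_borel (G n)) (return borel y)"
    and K: "compact K" "\<And>n. measure_support (extend_borel (G n)) \<subseteq> K"
    using dirac unfolding dirac_approximation_def by metis
  have i: "integrable (G n) (\<lambda>z. V x z $ i)" "integrable (G n) (\<lambda>z. V' x z $ i)" for n i
    using int x G by (auto simp: class_integrable_def)
  have "(\<lambda>n. integrated V' x (G n)) \<longlonglongrightarrow> V' x y"
    by (rule tendsto_integrated_dirac[where G = G and V = V' and x = x,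
          OF dist[OF G] weak K i(2) y cont(2) lb(2)])
  moreover have "(\<lambda>n. H *v integrated V x (G n)) \<longlonglongrightarrow> H *v V x y"
    by (intro bounded_linear.tendsto[OF matrix_vector_mul_bounded_linear]
        tendsto_integrated_dirac[where G = G and V = V and x = x,
          OF dist[OF G] weak K i(1) y cont(1) lb(1)])
  ultimately show ?thesis
    using LIMSEQ_unique by (simp add: eq[OF G])
qed

text \<open>
  A null set of exceptional actions \<open>x\<close> becomes a null set of pairs \<open>(x, y)\<close>, so that both parts of
  the regularity condition hold for almost every pair.
\<close>

lemma AE_regular_points:
  fixes V V' :: "real ^ 'k \<Rightarrow> real ^ 'd \<Rightarrow> real ^ 'k"
  assumes reg: "regularity_condition Act Obs V V'"
  shows "AE (x, y) in lebesgue. (x, y) \<in> interior Act \<times> Obs \<longrightarrow>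
     (continuous (at y within Obs) (V x) \<and> continuous (at y within Obs) (V' x)) \<and>
     (locally_bounded_on Obs (V x) \<and> locally_bounded_on Obs (V' x))"
proof -
  let ?lb = "\<lambda>x. x \<in> interior Act \<longrightarrow> locally_bounded_on Obs (V x) \<and> locally_bounded_on Obs (V' x)"
  have "AE x in lborel. ?lb x"
    using reg by (simp add: regularity_condition_def AE_completion_iff)
  then have "AE z in (lborel :: ((real ^ 'k) \<times> (real ^ 'd)) measure). ?lb (fst z)"
    by (rule AE_lborel_fst)
  then have "AE z in (lebesgue :: ((real ^ 'k) \<times> (real ^ 'd)) measure). ?lb (fst z)"
    by (rule AE_completion)
  moreover have "AE z in lebesgue. z \<notin> (interior Act \<times> Obs) -
       {(x, y) \<in> interior Act \<times> Obs.
          continuous (at y within Obs) (V x) \<and> continuous (at y within Obs) (V' x)}"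
    using reg by (intro AE_not_in) (simp add: regularity_condition_def)
  ultimately show ?thesis
    by eventually_elim auto
qed

theorem theorem4:
  fixes Obs :: "(real ^ 'd) set"
    and Act :: "(real ^ 'k) set"
    and FF :: "(real ^ 'd) measure set"
    and T :: "(real ^ 'd) measure \<Rightarrow> (real ^ 'k) set"
    and V :: "real ^ 'k \<Rightarrow> real ^ 'd \<Rightarrow> real ^ 'k"
  assumes "\<And>F. F \<in> FF \<Longrightarrow> distribution_on Obs F"
    and "\<And>F. F \<in> FF \<Longrightarrow> T F \<subseteq> Act"
    and "strict_identification_function Act FF T V"
  shows
    "(\<forall>h :: real ^ 'k \<Rightarrow> real ^ 'k ^ 'k.
        (\<forall>x\<in>Act. det (h x) \<noteq> 0) \<longrightarrow>
        strict_identification_function Act FF T (\<lambda>x y. h x *v V x y)) \<and>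
     (convex_class FF \<and> richness_condition Act FF V \<longrightarrow>
      (\<forall>V' :: real ^ 'k \<Rightarrow> real ^ 'd \<Rightarrow> real ^ 'k.
        identification_function Act FF T V' \<longrightarrow>
        (\<exists>h :: real ^ 'k \<Rightarrow> real ^ 'k ^ 'k.
          (\<forall>x\<in>interior Act. \<forall>F\<in>FF. integrated V' x F = h x *v integrated V x F) \<and>
          (strict_identification_function Act FF T V' \<and> richness_condition Act FF V' \<longrightarrow>
            (\<forall>x\<in>interior Act. det (h x) \<noteq> 0)) \<and>
          ((\<forall>F\<in>FF. continuous_on Act (\<lambda>x. integrated V x F) \<and>
                   continuous_on Act (\<lambda>x. integrated V' x F)) \<longrightarrow>
            continuous_on (interior Act) h \<and>
            (strict_identification_function Act FF T V' \<and> richness_condition Act FF V' \<and>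
             connected (interior Act) \<longrightarrow>
              (\<forall>x\<in>interior Act. 0 < det (h x)) \<or> (\<forall>x\<in>interior Act. det (h x) < 0))) \<and>
          (dirac_approximation FF \<and> regularity_condition Act Obs V V' \<longrightarrow>
            (AE (x, y) in lebesgue. (x, y) \<in> interior Act \<times> Obs \<longrightarrow>
               V' x y = h x *v V x y)))))"
proof (intro conjI allI impI, goal_cases)
  case (1 h)
  then show ?case
    using strict_identification_function_matrix_mult[OF assms(3), of h] by blast
next
  case (2 V')
  then have FF: "convex_class FF" and rich: "richness_condition Act FF V"
    and V': "identification_function Act FF T V'" by auto
  have sets: "sets N = sets M" if "M \<in> FF" "N \<in> FF" for M N
    using assms(1)[OF that(1)] assms(1)[OF that(2)] by (simp add: distribution_on_def)
  have int: "class_integrable Act FF V" "class_integrable Act FF V'"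
    using assms(3) V' by (auto simp: strict_identification_function_def identification_function_def)
  have rich_int: "0 \<in> interior (integrated V x ` FF)" if "x \<in> interior Act" for x
    by (rule richness_imp_interior_integrated[OF int(1) sets FF rich that])
  have "\<exists>H. \<forall>F\<in>FF. integrated V' x F = H *v integrated V x F" if "x \<in> interior Act" for x
    by (rule identification_functions_matrix[OF assms(3) V' sets FF rich that])
  then obtain h where h: "\<And>x F. x \<in> interior Act \<Longrightarrow> F \<in> FF \<Longrightarrow>
      integrated V' x F = h x *v integrated V x F"
    by metis
  have nz: "det (h x) \<noteq> 0"
    if "richness_condition Act FF V'" and x: "x \<in> interior Act" for x
  proof (rule det_nonzero_if_range_has_interior)
    show "integrated V' x ` FF \<subseteq> range ((*v) (h x))" using h[OF x] by auto
    show "interior (integrated V' x ` FF) \<noteq> {}"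
      using richness_imp_interior_integrated[OF int(2) sets FF that] by blast
  qed
  have cont: "continuous_on (interior Act) h"
    if "\<forall>F\<in>FF. continuous_on Act (\<lambda>x. integrated V x F) \<and>
                   continuous_on Act (\<lambda>x. integrated V' x F)"
    using that by (intro continuous_on_matrix_if_values_continuous[OF h rich_int])
      (auto intro: continuous_on_subset[OF _ interior_subset])
  have ae: "AE (x, y) in lebesgue. (x, y) \<in> interior Act \<times> Obs \<longrightarrow> V' x y = h x *v V x y"
    if dirac: "dirac_approximation FF" and reg: "regularity_condition Act Obs V V'"
    using AE_regular_points[OF reg]
  proof eventually_elim
    case (elim z)
    obtain x y where z: "z = (x, y)" by (cases z)
    have "V' x y = h x *v V x y" if xy: "x \<in> interior Act" "y \<in> Obs"
    proof (rule integrated_identity_at_dirac[OF assms(1) dirac int])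
      show "x \<in> Act" using xy interior_subset by blast
      show "integrated V' x F = h x *v integrated V x F" if "F \<in> FF" for F
        using h[OF xy(1) that] .
    qed (use elim z xy in auto)
    then show ?case by (auto simp: z)
  qed
  show ?case
  proof (intro exI[of _ h] conjI impI)
    show "\<forall>x\<in>interior Act. \<forall>F\<in>FF. integrated V' x F = h x *v integrated V x F"
      using h by blast
  qed (use nz cont ae det_constant_sign[of "interior Act" h] in auto)
qed

end
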